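(* Let $f\in\mathcal{A}$. If there exists a prime integer $p$ for which $f(p)\neq 0$, then $\langle f\rangle$ is a prime ideal of $\mathcal{A}$.
   Context: $\mathds{N}$ denotes the non-negative integers and $\mathds{N}^+=\mathds{N}\setminus\{0\}$. $\mathcal{A}$ is the ring of arithmetical functions: the set of all functions $f\colon \mathds{N}^+\to\mathds{C}$ with pointwise addition $(f+g)(n)=f(n)+g(n)$ and Dirichlet convolution $(f*g)(n)=\sum_{ij=n}f(i)g(j)$ as multiplication. It is a commutative ring with identity $e$, where $e(1)=1$ and $e(n)=0$ for $n>1$. $\langle f\rangle$ denotes the ideal of $\mathcal{A}$ generated by $f$.
   Formalization: If f is a unit (f(1) ≠ 0, e.g. f(n)=1 for all n), ⟨f⟩ is all of 𝒜 and not a proper prime ideal; "prime ideal" in the strict sense is claimed only for non-units f, and for every f only that ab∈⟨f⟩ implies a∈⟨f⟩ or b∈⟨f⟩. *)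

theory Defs
  imports Complex_Main "HOL-Library.FuncSet" "HOL-Computational_Algebra.Primes" "HOL-Algebra.Ideal"
begin

text \<open>
  Functions on the positive integers are represented extensionally: as functions on
  \<open>nat\<close> whose value at \<open>0\<close> is \<open>undefined\<close>, so that equality on the carrier
  is equality of functions on the positive integers.
\<close>

definition arithmetical_ring :: "(nat \<Rightarrow> complex) ring" where
  "arithmetical_ring =
    \<lparr> carrier = {0<..} \<rightarrow>\<^sub>E UNIV,
      mult = (\<lambda>f g. \<lambda>n\<in>{0<..}. \<Sum>(i, j) | i * j = n. f i * g j),
      one = (\<lambda>n\<in>{0<..}. if n = 1 then 1 else 0),
      zero = (\<lambda>n\<in>{0<..}. 0),
      add = (\<lambda>f g. \<lambda>n\<in>{0<..}. f n + g n) \<rparr>"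

text \<open>
  The locale \<open>primeideal\<close> additionally demands that the ideal be proper. The predicate
  below does not, so it also admits the whole ring. This matters when \<open>f 1 \<noteq> 0\<close>: then
  \<open>f\<close> is a unit and generates the whole ring.
\<close>

definition prime_ideal_or_whole :: "'a set \<Rightarrow> ('a, 'b) ring_scheme \<Rightarrow> bool" where
  "prime_ideal_or_whole I R \<longleftrightarrow>
    ideal I R \<and>
    (\<forall>a\<in>carrier R. \<forall>b\<in>carrier R. a \<otimes>\<^bsub>R\<^esub> b \<in> I \<longrightarrow> a \<in> I \<or> b \<in> I)"

end

theory Submission
  imports Defs
begin

text \<open>
  If \<open>f 1 \<noteq> 0\<close>, then \<open>f\<close> divides everything and there is nothing to do. So let
  \<open>f 1 = 0\<close> and let \<open>p\<close> be a prime with \<open>f p \<noteq> 0\<close>. Unique factorisation turns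
  arithmetical functions into formal power series in one variable for each prime, and in this
  picture \<open>f\<close> has no constant term but has a nonzero coefficient at the variable \<open>x\<^sub>p\<close>.
  Thus \<open>f\<close> is regular of order one in \<open>x\<^sub>p\<close>, and Weierstrass division by \<open>f\<close> leaves a
  remainder that is free of \<open>x\<^sub>p\<close>: every \<open>a\<close> is \<open>q * f + r\<close>, where \<open>r\<close> vanishes at the
  multiples of \<open>p\<close>. Moreover no nonzero multiple of \<open>f\<close> is free of \<open>x\<^sub>p\<close>. So the quotient
  by \<open>f\<close> is isomorphic to the ring of series free of \<open>x\<^sub>p\<close>, which is a domain.

  In concrete terms: if \<open>f\<close> divides \<open>a * b\<close>, then it divides the product of the remainders of
  \<open>a\<close> and \<open>b\<close>. That product is again free of \<open>x\<^sub>p\<close>, since a prime dividing \<open>i * j\<close>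
  divides \<open>i\<close> or \<open>j\<close>. Hence it is zero, and one of the two remainders is zero.

  Both halves of the division statement concern the values of \<open>q * f\<close> at the numbers
  \<open>p * m\<close>. Prescribing them is a linear system for the values \<open>q d\<close>, and the point is that
  the system is triangular, with the nonzero diagonal entry \<open>f p\<close>, for a well-founded ordering of
  the positive integers that compares first the parts prime to \<open>p\<close>. The case of a unit is the
  same system with \<open>1\<close> in place of \<open>p\<close> and the usual ordering; so division in both
  cases is \<open>triangular_solution_exists\<close>, and uniqueness is \<open>triangular_solution_unique\<close>.
\<close>

section \<open>The ring of arithmetical functions\<close>

lemma carrier_arithmetical_ring: "carrier arithmetical_ring = {0<..} \<rightarrow>\<^sub>E UNIV"
  and mult_arithmetical_ring:
    "f \<otimes>\<^bsub>arithmetical_ring\<^esub> g = (\<lambda>n\<in>{0<..}. \<Sum>(i, j) | i * j = n. f i * g j)"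
  and one_arithmetical_ring: "\<one>\<^bsub>arithmetical_ring\<^esub> = (\<lambda>n\<in>{0<..}. if n = 1 then 1 else 0)"
  and zero_arithmetical_ring: "\<zero>\<^bsub>arithmetical_ring\<^esub> = (\<lambda>n\<in>{0<..}. 0)"
  and add_arithmetical_ring: "f \<oplus>\<^bsub>arithmetical_ring\<^esub> g = (\<lambda>n\<in>{0<..}. f n + g n)"
  by (simp_all add: arithmetical_ring_def)

lemma arithmetical_ring_eqI:
  assumes "f \<in> carrier arithmetical_ring" "g \<in> carrier arithmetical_ring"
    and "\<And>n. n > 0 \<Longrightarrow> f n = g n"
  shows "f = g"
  using assms by (auto simp: carrier_arithmetical_ring intro: PiE_ext)

lemma mult_apply:
  "n > 0 \<Longrightarrow> (f \<otimes>\<^bsub>arithmetical_ring\<^esub> g) n = (\<Sum>(i, j) | i * j = n. f i * g j)"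
  by (simp add: mult_arithmetical_ring)

lemma finite_factor_pairs:
  assumes "(n::nat) > 0"
  shows "finite {(i, j). i * j = n}"
proof (rule finite_subset)
  show "{(i, j). i * j = n} \<subseteq> {..n} \<times> {..n}"
    using assms by (auto dest: dvd_imp_le[OF dvd_triv_left] dvd_imp_le[OF dvd_triv_right])
qed auto

lemma mult_comm_arithmetical_ring:
  "f \<otimes>\<^bsub>arithmetical_ring\<^esub> g = g \<otimes>\<^bsub>arithmetical_ring\<^esub> f"
  unfolding mult_arithmetical_ring
proof (rule restrict_ext)
  fix n :: nat
  show "(\<Sum>(i, j) | i * j = n. f i * g j) = (\<Sum>(i, j) | i * j = n. g i * f j)"
    by (rule sum.reindex_bij_witness[of _ "\<lambda>(i, j). (j, i)" "\<lambda>(i, j). (j, i)"])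
      (auto simp: mult.commute)
qed

text \<open>Bracketing either way gives the sum over the ordered factorisations in three factors.\<close>

lemma mult_assoc_arithmetical_ring:
  "(f \<otimes>\<^bsub>arithmetical_ring\<^esub> g) \<otimes>\<^bsub>arithmetical_ring\<^esub> h =
    f \<otimes>\<^bsub>arithmetical_ring\<^esub> (g \<otimes>\<^bsub>arithmetical_ring\<^esub> h)"
  (is "?l = ?r")
proof (rule arithmetical_ring_eqI)
  fix n :: nat
  assume n: "n > 0"
  let ?P = "\<lambda>k::nat. {(i, j). i * j = k}"
  have pos: "i > 0" "j > 0" if "(i, j) \<in> ?P n" for i j
    using that n by (auto intro!: Nat.gr0I)
  have fin: "finite (?P (fst x))" "finite (?P (snd x))" if "x \<in> ?P n" for x
    using pos[of "fst x" "snd x"] that by (auto intro!: finite_factor_pairs)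
  have "?l n = (\<Sum>x\<in>?P n. \<Sum>y\<in>?P (fst x). f (fst y) * g (snd y) * h (snd x))"
    unfolding mult_apply[OF n] using pos
    by (intro sum.cong) (auto simp: mult_apply sum_distrib_right case_prod_unfold)
  also have "\<dots> = (\<Sum>(x, y)\<in>(SIGMA x:?P n. ?P (fst x)). f (fst y) * g (snd y) * h (snd x))"
    by (intro sum.Sigma finite_factor_pairs[OF n] ballI fin)
  also have "\<dots> = (\<Sum>(x, y)\<in>(SIGMA x:?P n. ?P (snd x)). f (fst x) * (g (fst y) * h (snd y)))"
    by (rule sum.reindex_bij_witness[of _
          "\<lambda>((i, m), (j, k)). ((i * j, k), (i, j))" "\<lambda>((m, k), (i, j)). ((i, j * k), (j, k))"])
      (auto simp: mult.assoc)
  also have "\<dots> = (\<Sum>x\<in>?P n. \<Sum>y\<in>?P (snd x). f (fst x) * (g (fst y) * h (snd y)))"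
    by (intro sum.Sigma[symmetric] finite_factor_pairs[OF n] ballI fin)
  also have "\<dots> = ?r n"
    unfolding mult_apply[OF n] using pos
    by (intro sum.cong) (auto simp: mult_apply sum_distrib_left case_prod_unfold)
  finally show "?l n = ?r n" .
qed (simp_all add: carrier_arithmetical_ring mult_arithmetical_ring)

lemma one_mult_arithmetical_ring:
  assumes "f \<in> carrier arithmetical_ring"
  shows "\<one>\<^bsub>arithmetical_ring\<^esub> \<otimes>\<^bsub>arithmetical_ring\<^esub> f = f"
proof (rule arithmetical_ring_eqI)
  fix n :: nat
  assume n: "n > 0"
  have "(\<one>\<^bsub>arithmetical_ring\<^esub> \<otimes>\<^bsub>arithmetical_ring\<^esub> f) n
      = (\<Sum>(i, j)\<in>{(1, n)}. \<one>\<^bsub>arithmetical_ring\<^esub> i * f j)"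
    unfolding mult_apply[OF n] using n
    by (intro sum.mono_neutral_right finite_factor_pairs)
      (auto simp: one_arithmetical_ring split: if_splits)
  then show "(\<one>\<^bsub>arithmetical_ring\<^esub> \<otimes>\<^bsub>arithmetical_ring\<^esub> f) n = f n"
    by (simp add: one_arithmetical_ring)
qed (use assms in \<open>simp_all add: carrier_arithmetical_ring mult_arithmetical_ring\<close>)

lemma add_mult_arithmetical_ring:
  "(f \<oplus>\<^bsub>arithmetical_ring\<^esub> g) \<otimes>\<^bsub>arithmetical_ring\<^esub> h =
    f \<otimes>\<^bsub>arithmetical_ring\<^esub> h \<oplus>\<^bsub>arithmetical_ring\<^esub> g \<otimes>\<^bsub>arithmetical_ring\<^esub> h"
  (is "?l = ?r")
proof (rule arithmetical_ring_eqI)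
  fix n :: nat
  assume n: "n > 0"
  have "?l n = (\<Sum>(i, j) | i * j = n. f i * h j + g i * h j)"
    unfolding mult_apply[OF n] using n
    by (intro sum.cong) (auto simp: add_arithmetical_ring distrib_right)
  also have "\<dots> = ?r n"
    using n by (simp add: add_arithmetical_ring mult_apply sum.distrib case_prod_unfold)
  finally show "?l n = ?r n" .
qed (simp_all add: carrier_arithmetical_ring mult_arithmetical_ring add_arithmetical_ring)

lemma cring_arithmetical_ring: "cring arithmetical_ring"
proof (rule cringI)
  show "abelian_group arithmetical_ring"
  proof (rule abelian_groupI)
    fix f assume f: "f \<in> carrier arithmetical_ring"
    show "\<exists>g\<in>carrier arithmetical_ring. g \<oplus>\<^bsub>arithmetical_ring\<^esub> f = \<zero>\<^bsub>arithmetical_ring\<^esub>"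
      by (rule bexI[of _ "\<lambda>n\<in>{0<..}. - f n"])
        (auto simp: carrier_arithmetical_ring zero_arithmetical_ring add_arithmetical_ring)
    show "\<zero>\<^bsub>arithmetical_ring\<^esub> \<oplus>\<^bsub>arithmetical_ring\<^esub> f = f"
      using f by (intro arithmetical_ring_eqI)
        (auto simp: carrier_arithmetical_ring zero_arithmetical_ring add_arithmetical_ring)
  qed (auto simp: carrier_arithmetical_ring zero_arithmetical_ring add_arithmetical_ring
      algebra_simps intro!: restrict_ext)
  show "comm_monoid arithmetical_ring"
    by (rule comm_monoidI)
      (auto simp: mult_assoc_arithmetical_ring one_mult_arithmetical_ring
        intro: mult_comm_arithmetical_ring,
       auto simp: carrier_arithmetical_ring mult_arithmetical_ring one_arithmetical_ring)
qed (rule add_mult_arithmetical_ring)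

text \<open>
  As for power series, lowest terms multiply: at the product of the least elements of the two
  supports only one factorisation contributes.
\<close>

lemma mult_eq_zero_arithmetical_ring:
  assumes f: "f \<in> carrier arithmetical_ring" and g: "g \<in> carrier arithmetical_ring"
    and fg: "f \<otimes>\<^bsub>arithmetical_ring\<^esub> g = \<zero>\<^bsub>arithmetical_ring\<^esub>"
  shows "f = \<zero>\<^bsub>arithmetical_ring\<^esub> \<or> g = \<zero>\<^bsub>arithmetical_ring\<^esub>"
proof (rule ccontr)
  assume "\<not> ?thesis"
  moreover have "\<exists>n>0. h n \<noteq> 0"
    if "h \<in> carrier arithmetical_ring" "h \<noteq> \<zero>\<^bsub>arithmetical_ring\<^esub>" for h
  proof (rule ccontr)
    assume "\<not> ?thesis"
    then have "h n = 0" if "n > 0" for n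
      using that by blast
    then have "h = \<zero>\<^bsub>arithmetical_ring\<^esub>"
      using that(1)
      by (intro arithmetical_ring_eqI) (auto simp: zero_arithmetical_ring carrier_arithmetical_ring)
    with that(2) show False by simp
  qed
  ultimately have exf: "\<exists>n>0. f n \<noteq> 0" and exg: "\<exists>n>0. g n \<noteq> 0"
    using f g by auto
  define a where "a = (LEAST n. n > 0 \<and> f n \<noteq> 0)"
  define b where "b = (LEAST n. n > 0 \<and> g n \<noteq> 0)"
  have a: "a > 0" "f a \<noteq> 0"
    using LeastI_ex[OF exf] by (simp_all add: a_def)
  have b: "b > 0" "g b \<noteq> 0"
    using LeastI_ex[OF exg] by (simp_all add: b_def)
  have fa: "a \<le> i" if "i > 0" "f i \<noteq> 0" for i
    unfolding a_def using that by (intro Least_le) simp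
  have gb: "b \<le> j" if "j > 0" "g j \<noteq> 0" for j
    unfolding b_def using that by (intro Least_le) simp
  have only: "(i, j) = (a, b)" if ij: "i * j = a * b" and "f i * g j \<noteq> 0" for i j
  proof -
    have "i > 0" "j > 0"
      using ij a(1) b(1) by (auto intro!: Nat.gr0I)
    then have le: "a \<le> i" "b \<le> j"
      using that by (auto intro: fa gb)
    have "i = a"
    proof (rule ccontr)
      assume "i \<noteq> a"
      then have "a * b < i * j"
        using le b(1) by (intro mult_less_le_imp_less) auto
      with ij show False by simp
    qed
    with ij a(1) show ?thesis by simp
  qed
  have "(f \<otimes>\<^bsub>arithmetical_ring\<^esub> g) (a * b) = (\<Sum>(i, j) | i * j = a * b. f i * g j)"
    using a(1) b(1) by (intro mult_apply) simp
  also have "\<dots> = (\<Sum>(i, j)\<in>{(a, b)}. f i * g j)"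
    using a(1) b(1) only by (intro sum.mono_neutral_right finite_factor_pairs) auto
  also have "\<dots> \<noteq> 0"
    using a b by simp
  finally show False
    using a(1) b(1) by (simp add: fg zero_arithmetical_ring)
qed

section \<open>Division as a triangular linear system\<close>

text \<open>
  The value of \<open>q * f\<close> at \<open>c * m\<close> is \<open>q m * f c\<close> plus terms \<open>q d * f e\<close>. The
  hypothesis \<open>triangular\<close> below says that these other terms vanish unless \<open>d\<close> precedes
  \<open>m\<close>.
\<close>

lemma triangular_mult_apply:
  fixes f q :: "nat \<Rightarrow> complex"
  assumes "wf R"
    and triangular: "\<And>d e m. \<lbrakk>d * e = c * m; m > 0; d \<noteq> m; f e \<noteq> 0\<rbrakk> \<Longrightarrow> (d, m) \<in> R"
    and c: "c > 0" and m: "m > 0"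
  shows "(q \<otimes>\<^bsub>arithmetical_ring\<^esub> f) (c * m) =
    q m * f c + (\<Sum>(d, e) | d * e = c * m \<and> (d, m) \<in> R. q d * f e)"
proof -
  let ?S = "{(d, e). d * e = c * m \<and> (d, m) \<in> R}"
  have fin: "finite {(d, e). d * e = c * m}"
    using c m by (intro finite_factor_pairs) simp
  have finS: "finite ?S"
    by (rule finite_subset[OF _ fin]) auto
  have notin: "(m, c) \<notin> ?S"
    using \<open>wf R\<close> by (auto simp: wf_not_refl)
  have "(q \<otimes>\<^bsub>arithmetical_ring\<^esub> f) (c * m) = (\<Sum>(d, e) | d * e = c * m. q d * f e)"
    using c m by (intro mult_apply) simp
  also have "\<dots> = (\<Sum>(d, e)\<in>insert (m, c) ?S. q d * f e)"
  proof (rule sum.mono_neutral_right[OF fin])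
    show "insert (m, c) ?S \<subseteq> {(d, e). d * e = c * m}"
      by auto
    show "\<forall>x\<in>{(d, e). d * e = c * m} - insert (m, c) ?S. (case x of (d, e) \<Rightarrow> q d * f e) = 0"
    proof
      fix x
      assume x: "x \<in> {(d, e). d * e = c * m} - insert (m, c) ?S"
      obtain d e where de: "x = (d, e)" "d * e = c * m"
        using x by auto
      have "d \<noteq> m"
        using x de m by auto
      then have "f e = 0"
        using triangular[OF de(2) m] x de by auto
      then show "(case x of (d, e) \<Rightarrow> q d * f e) = 0"
        by (simp add: de)
    qed
  qed
  also have "\<dots> = q m * f c + (\<Sum>(d, e)\<in>?S. q d * f e)"
    using finS notin by simp
  finally show ?thesis .
qed

lemma triangular_solution_exists:
  fixes f a :: "nat \<Rightarrow> complex"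
  assumes wf: "wf R"
    and triangular: "\<And>d e m. \<lbrakk>d * e = c * m; m > 0; d \<noteq> m; f e \<noteq> 0\<rbrakk> \<Longrightarrow> (d, m) \<in> R"
    and c: "c > 0" "f c \<noteq> 0"
  shows "\<exists>q\<in>carrier arithmetical_ring. \<forall>m>0. (q \<otimes>\<^bsub>arithmetical_ring\<^esub> f) (c * m) = a (c * m)"
proof -
  define F where "F = (\<lambda>q m. if m = 0 then undefined
    else (a (c * m) - (\<Sum>(d, e) | d * e = c * m \<and> (d, m) \<in> R. q d * f e)) / f c)"
  have "adm_wf R F"
    unfolding adm_wf_def F_def by (auto intro!: sum.cong)
  then have "wfrec R F m = F (wfrec R F) m" for m
    using wfrec_fixpoint[OF wf] by metis
  \<comment> \<open>Only the outer \<open>F\<close> is to be expanded, not the one inside \<open>wfrec R F\<close>.\<close>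
  note q = this[unfolded F_def, folded F_def]
  have "wfrec R F \<in> carrier arithmetical_ring"
    by (auto simp: carrier_arithmetical_ring PiE_iff extensional_def q[of 0])
  moreover have "(wfrec R F \<otimes>\<^bsub>arithmetical_ring\<^esub> f) (c * m) = a (c * m)" if m: "m > 0" for m
  proof -
    have "(wfrec R F \<otimes>\<^bsub>arithmetical_ring\<^esub> f) (c * m) =
        wfrec R F m * f c + (\<Sum>(d, e) | d * e = c * m \<and> (d, m) \<in> R. wfrec R F d * f e)"
      by (rule triangular_mult_apply[OF wf _ c(1) m]) (rule triangular)
    then show ?thesis
      using m c by (simp add: q[of m])
  qed
  ultimately show ?thesis by blast
qed

lemma triangular_solution_unique:
  fixes f q :: "nat \<Rightarrow> complex"
  assumes wf: "wf R"
    and triangular: "\<And>d e m. \<lbrakk>d * e = c * m; m > 0; d \<noteq> m; f e \<noteq> 0\<rbrakk> \<Longrightarrow> (d, m) \<in> R"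
    and c: "c > 0" "f c \<noteq> 0"
    and q: "q \<in> carrier arithmetical_ring"
    and vanish: "\<And>m. m > 0 \<Longrightarrow> (q \<otimes>\<^bsub>arithmetical_ring\<^esub> f) (c * m) = 0"
  shows "q = \<zero>\<^bsub>arithmetical_ring\<^esub>"
proof (rule arithmetical_ring_eqI[OF q])
  have "m > 0 \<longrightarrow> q m = 0" for m
    using wf
  proof (induction m rule: wf_induct_rule)
    case (less m)
    show ?case
    proof
      assume m: "m > 0"
      have "d > 0" if "d * e = c * m" for d e
        using that m c(1) by (auto intro!: Nat.gr0I)
      then have "(\<Sum>(d, e) | d * e = c * m \<and> (d, m) \<in> R. q d * f e) = 0"
        using less by (intro sum.neutral) auto
      with vanish[OF m] triangular_mult_apply[OF wf triangular c(1) m, where q = q and f = f]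
      show "q m = 0"
        using c(2) by simp
    qed
  qed
  then show "q n = \<zero>\<^bsub>arithmetical_ring\<^esub> n" if "n > 0" for n
    using that by (simp add: zero_arithmetical_ring)
qed (simp add: carrier_arithmetical_ring zero_arithmetical_ring)

lemma divides_all_if_nonzero_at_one:
  fixes f a :: "nat \<Rightarrow> complex"
  assumes "f 1 \<noteq> 0" "a \<in> carrier arithmetical_ring"
  shows "\<exists>q\<in>carrier arithmetical_ring. a = q \<otimes>\<^bsub>arithmetical_ring\<^esub> f"
proof -
  have "\<exists>q\<in>carrier arithmetical_ring. \<forall>m>0. (q \<otimes>\<^bsub>arithmetical_ring\<^esub> f) (1 * m) = a (1 * m)"
  proof (rule triangular_solution_exists[OF wf_less_than])
    fix d e m :: nat
    assume "d * e = 1 * m" "m > 0" "d \<noteq> m"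
    then have "d dvd m" by (metis dvd_triv_left mult_1)
    then show "(d, m) \<in> less_than"
      using \<open>m > 0\<close> \<open>d \<noteq> m\<close> by (simp add: dvd_imp_le le_neq_trans)
  qed (use assms(1) in simp_all)
  then obtain q where q: "q \<in> carrier arithmetical_ring"
    and qf: "\<forall>m>0. (q \<otimes>\<^bsub>arithmetical_ring\<^esub> f) m = a m"
    by auto
  have "a = q \<otimes>\<^bsub>arithmetical_ring\<^esub> f"
    using qf assms(2)
    by (intro arithmetical_ring_eqI) (simp_all add: carrier_arithmetical_ring mult_arithmetical_ring)
  with q show ?thesis by blast
qed

section \<open>Weierstrass division\<close>

text \<open>
  The ordering is lexicographic: first the part prime to \<open>p\<close>, then the size. The first entry can
  only decrease when passing to a factor \<open>d\<close> of \<open>p * m\<close>, since multiplying by \<open>p\<close> leaves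
  it alone. If it stays the same, the cofactor \<open>e\<close> is a power of \<open>p\<close>; it is neither \<open>1\<close>
  nor \<open>p\<close>, so it exceeds \<open>p\<close>, and then \<open>d < m\<close>.
\<close>

lemma prime_cofactor_descent:
  fixes p d e m :: nat
  assumes p: "prime p" and de: "d * e = p * m" and m: "m > 0" and dm: "d \<noteq> m" and e: "e \<noteq> 1"
  shows "(d, m) \<in> measures [\<lambda>n. n div p ^ multiplicity p n, \<lambda>n. n]"
proof -
  let ?u = "\<lambda>n. n div p ^ multiplicity p n"
  have pos: "p > 0" "d > 0" "e > 0"
    using p m de by (auto intro!: Nat.gr0I simp: prime_gt_0_nat)
  have u_mult: "?u (x * y) = ?u x * ?u y" if "x > 0" "y > 0" for x y
    using p that
    by (simp add: prime_elem_multiplicity_mult_distrib power_add div_mult_div_if_dvd multiplicity_dvd)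
  have "?u p = 1"
    using p pos by (simp add: multiplicity_self not_prime_unit)
  then have u: "?u d * ?u e = ?u m"
    using u_mult[OF pos(2,3)] u_mult[OF pos(1) m] de by simp
  have u_pos: "?u n > 0" if "n > 0" for n
    using that pos by (simp add: div_greater_zero_iff dvd_imp_le multiplicity_dvd)
  show ?thesis
  proof (cases "?u e = 1")
    case False
    with u_pos[OF pos(3)] have "1 < ?u e" by linarith
    then have "?u d * 1 < ?u d * ?u e"
      using u_pos[OF pos(2)] by (intro mult_strict_left_mono) auto
    then show ?thesis by (simp add: u)
  next
    case True
    have e_pow: "e = p ^ multiplicity p e"
      using dvd_mult_div_cancel[OF multiplicity_dvd[of p e]] True by simp
    with e have "multiplicity p e \<noteq> 0" by (metis power_0)
    then have "p dvd e"
      by (metis e_pow dvd_power gr0I)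
    moreover have "e \<noteq> p"
      using de dm pos by auto
    ultimately have "p < e"
      using pos by (simp add: dvd_imp_le le_neq_trans)
    have "d < m"
    proof (rule ccontr)
      assume "\<not> d < m"
      then have "p * m < e * d"
        using \<open>p < e\<close> m by (intro mult_less_le_imp_less) auto
      with de show False by (simp add: mult.commute)
    qed
    with True u show ?thesis by simp
  qed
qed

lemma weierstrass_division:
  fixes f a :: "nat \<Rightarrow> complex"
  assumes p: "prime p" "f p \<noteq> 0" and f1: "f 1 = 0" and a: "a \<in> carrier arithmetical_ring"
  shows "\<exists>q\<in>carrier arithmetical_ring. \<exists>r\<in>carrier arithmetical_ring.
    a = q \<otimes>\<^bsub>arithmetical_ring\<^esub> f \<oplus>\<^bsub>arithmetical_ring\<^esub> r \<and> (\<forall>m>0. r (p * m) = 0)"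
proof -
  have "\<exists>q\<in>carrier arithmetical_ring. \<forall>m>0. (q \<otimes>\<^bsub>arithmetical_ring\<^esub> f) (p * m) = a (p * m)"
  proof (rule triangular_solution_exists[OF wf_measures])
    show "(d, m) \<in> measures [\<lambda>n. n div p ^ multiplicity p n, \<lambda>n. n]"
      if "d * e = p * m" "m > 0" "d \<noteq> m" "f e \<noteq> 0" for d e m
      using that f1 by (intro prime_cofactor_descent[OF p(1)]) auto
  qed (use p in \<open>simp_all add: prime_gt_0_nat\<close>)
  then obtain q where q: "q \<in> carrier arithmetical_ring"
    and qf: "\<forall>m>0. (q \<otimes>\<^bsub>arithmetical_ring\<^esub> f) (p * m) = a (p * m)"
    by blast
  let ?r = "\<lambda>n\<in>{0<..}. a n - (q \<otimes>\<^bsub>arithmetical_ring\<^esub> f) n"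
  have "?r \<in> carrier arithmetical_ring"
    by (simp add: carrier_arithmetical_ring)
  moreover have "a = q \<otimes>\<^bsub>arithmetical_ring\<^esub> f \<oplus>\<^bsub>arithmetical_ring\<^esub> ?r"
    using a by (intro arithmetical_ring_eqI) (auto simp: carrier_arithmetical_ring add_arithmetical_ring)
  moreover have "\<forall>m>0. ?r (p * m) = 0"
    using qf p(1) by (simp add: prime_gt_0_nat)
  ultimately show ?thesis
    using q by blast
qed

lemma multiple_vanishing_at_prime_multiples:
  fixes f q :: "nat \<Rightarrow> complex"
  assumes p: "prime p" "f p \<noteq> 0" and f1: "f 1 = 0" and q: "q \<in> carrier arithmetical_ring"
    and vanish: "\<And>m. m > 0 \<Longrightarrow> (q \<otimes>\<^bsub>arithmetical_ring\<^esub> f) (p * m) = 0"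
  shows "q = \<zero>\<^bsub>arithmetical_ring\<^esub>"
proof (rule triangular_solution_unique[OF wf_measures, where c = p and f = f])
  show "(d, m) \<in> measures [\<lambda>n. n div p ^ multiplicity p n, \<lambda>n. n]"
    if "d * e = p * m" "m > 0" "d \<noteq> m" "f e \<noteq> 0" for d e m
    using that f1 by (intro prime_cofactor_descent[OF p(1)]) auto
qed (use p q vanish in \<open>simp_all add: prime_gt_0_nat\<close>)

text \<open>
  The series free of \<open>x\<^sub>p\<close> are closed under multiplication, because a factorisation of a
  multiple of the prime \<open>p\<close> always involves a multiple of \<open>p\<close>.
\<close>

lemma mult_vanishing_at_prime_multiples:
  fixes r s :: "nat \<Rightarrow> complex"
  assumes p: "prime p" and r: "\<And>m. m > 0 \<Longrightarrow> r (p * m) = 0" and s: "\<And>m. m > 0 \<Longrightarrow> s (p * m) = 0"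
    and m: "m > 0"
  shows "(r \<otimes>\<^bsub>arithmetical_ring\<^esub> s) (p * m) = 0"
proof -
  have pm: "p * m > 0"
    using m p by (simp add: prime_gt_0_nat)
  have "r i * s j = 0" if ij: "i * j = p * m" for i j
  proof -
    have pos: "i > 0" "j > 0"
      using ij pm by (auto intro!: Nat.gr0I)
    have "p dvd i \<or> p dvd j"
      using p ij by (metis dvd_triv_left prime_dvd_mult_iff)
    then show ?thesis
      using pos r s by (auto elim!: dvdE)
  qed
  then show ?thesis
    unfolding mult_apply[OF pm] by (intro sum.neutral) auto
qed

lemma divides_factor_if_nonzero_at_prime:
  fixes f a b h :: "nat \<Rightarrow> complex"
  assumes f: "f \<in> carrier arithmetical_ring" and p: "prime p" "f p \<noteq> 0" and f1: "f 1 = 0"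
    and a: "a \<in> carrier arithmetical_ring" and b: "b \<in> carrier arithmetical_ring"
    and h: "h \<in> carrier arithmetical_ring"
    and ab: "a \<otimes>\<^bsub>arithmetical_ring\<^esub> b = h \<otimes>\<^bsub>arithmetical_ring\<^esub> f"
  shows "\<exists>q\<in>carrier arithmetical_ring.
    a = q \<otimes>\<^bsub>arithmetical_ring\<^esub> f \<or> b = q \<otimes>\<^bsub>arithmetical_ring\<^esub> f"
proof -
  interpret cring arithmetical_ring
    by (rule cring_arithmetical_ring)
  obtain q r where q: "q \<in> carrier arithmetical_ring" and r: "r \<in> carrier arithmetical_ring"
    and a_eq: "a = q \<otimes>\<^bsub>arithmetical_ring\<^esub> f \<oplus>\<^bsub>arithmetical_ring\<^esub> r"
    and r0: "\<forall>m>0. r (p * m) = 0"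
    using weierstrass_division[OF p f1 a] by blast
  obtain t s where t: "t \<in> carrier arithmetical_ring" and s: "s \<in> carrier arithmetical_ring"
    and b_eq: "b = t \<otimes>\<^bsub>arithmetical_ring\<^esub> f \<oplus>\<^bsub>arithmetical_ring\<^esub> s"
    and s0: "\<forall>m>0. s (p * m) = 0"
    using weierstrass_division[OF p f1 b] by blast
  \<comment> \<open>The cofactor of \<open>f\<close> in \<open>r * s\<close>, found from \<open>r * s = a * s - q * f * s\<close>
    and \<open>a * s = a * b - a * t * f\<close>.\<close>
  define k where "k = h \<ominus>\<^bsub>arithmetical_ring\<^esub> a \<otimes>\<^bsub>arithmetical_ring\<^esub> t
    \<ominus>\<^bsub>arithmetical_ring\<^esub> q \<otimes>\<^bsub>arithmetical_ring\<^esub> s"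
  have k: "k \<in> carrier arithmetical_ring"
    using h a t q s by (simp add: k_def)
  have r_eq: "r = a \<ominus>\<^bsub>arithmetical_ring\<^esub> q \<otimes>\<^bsub>arithmetical_ring\<^esub> f"
    unfolding a_eq using q f r by algebra
  have s_eq: "s = b \<ominus>\<^bsub>arithmetical_ring\<^esub> t \<otimes>\<^bsub>arithmetical_ring\<^esub> f"
    unfolding b_eq using t f s by algebra
  have "r \<otimes>\<^bsub>arithmetical_ring\<^esub> s =
      a \<otimes>\<^bsub>arithmetical_ring\<^esub> s \<ominus>\<^bsub>arithmetical_ring\<^esub> q \<otimes>\<^bsub>arithmetical_ring\<^esub> s \<otimes>\<^bsub>arithmetical_ring\<^esub> f"
    unfolding r_eq using a q f s by algebra
  also have "a \<otimes>\<^bsub>arithmetical_ring\<^esub> s =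
      a \<otimes>\<^bsub>arithmetical_ring\<^esub> b \<ominus>\<^bsub>arithmetical_ring\<^esub> a \<otimes>\<^bsub>arithmetical_ring\<^esub> t \<otimes>\<^bsub>arithmetical_ring\<^esub> f"
    unfolding s_eq using a b t f by algebra
  also note ab
  also have "h \<otimes>\<^bsub>arithmetical_ring\<^esub> f
      \<ominus>\<^bsub>arithmetical_ring\<^esub> a \<otimes>\<^bsub>arithmetical_ring\<^esub> t \<otimes>\<^bsub>arithmetical_ring\<^esub> f
      \<ominus>\<^bsub>arithmetical_ring\<^esub> q \<otimes>\<^bsub>arithmetical_ring\<^esub> s \<otimes>\<^bsub>arithmetical_ring\<^esub> f
      = k \<otimes>\<^bsub>arithmetical_ring\<^esub> f"
    unfolding k_def using h a t q s f by algebra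
  finally have rs: "r \<otimes>\<^bsub>arithmetical_ring\<^esub> s = k \<otimes>\<^bsub>arithmetical_ring\<^esub> f" .
  have "k = \<zero>\<^bsub>arithmetical_ring\<^esub>"
    using mult_vanishing_at_prime_multiples[OF p(1), of r s] r0 s0 rs
    by (intro multiple_vanishing_at_prime_multiples[OF p f1 k]) simp
  with rs f have "r \<otimes>\<^bsub>arithmetical_ring\<^esub> s = \<zero>\<^bsub>arithmetical_ring\<^esub>"
    by simp
  then have "r = \<zero>\<^bsub>arithmetical_ring\<^esub> \<or> s = \<zero>\<^bsub>arithmetical_ring\<^esub>"
    by (rule mult_eq_zero_arithmetical_ring[OF r s])
  then show ?thesis
    using a_eq b_eq q t f by auto
qed

section \<open>Primality of the generated ideal\<close>

theorem proposition3p1: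
  fixes f :: "nat \<Rightarrow> complex"
  assumes "f \<in> carrier arithmetical_ring"
    and "\<exists>p::nat. prime p \<and> f p \<noteq> 0"
  shows "prime_ideal_or_whole (Idl\<^bsub>arithmetical_ring\<^esub> {f}) arithmetical_ring \<and>
    (f \<notin> Units arithmetical_ring \<longrightarrow>
      primeideal (Idl\<^bsub>arithmetical_ring\<^esub> {f}) arithmetical_ring)"
proof -
  interpret cring arithmetical_ring
    by (rule cring_arithmetical_ring)
  let ?I = "Idl\<^bsub>arithmetical_ring\<^esub> {f}"
  note f = assms(1)
  obtain p where p: "prime p" "f p \<noteq> 0"
    using assms(2) by blast
  have ideal: "ideal ?I arithmetical_ring"
    using f by (intro genideal_ideal) simp
  have mem: "x \<in> ?I \<longleftrightarrow> (\<exists>q\<in>carrier arithmetical_ring. x = q \<otimes>\<^bsub>arithmetical_ring\<^esub> f)" for x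
    unfolding cgenideal_eq_genideal[OF f, symmetric] cgenideal_def by auto
  have dichotomy: "a \<in> ?I \<or> b \<in> ?I"
    if a: "a \<in> carrier arithmetical_ring" and b: "b \<in> carrier arithmetical_ring"
      and ab: "a \<otimes>\<^bsub>arithmetical_ring\<^esub> b \<in> ?I" for a b
  proof (cases "f 1 = 0")
    case True
    then show ?thesis
      using ab divides_factor_if_nonzero_at_prime[OF f p True a b] unfolding mem by blast
  next
    case False
    then show ?thesis
      using divides_all_if_nonzero_at_one[of f a] a unfolding mem by blast
  qed
  have "primeideal ?I arithmetical_ring" if "f \<notin> Units arithmetical_ring"
  proof (rule primeidealI[OF ideal is_cring])
    show "carrier arithmetical_ring \<noteq> ?I"
    proof
      assume "carrier arithmetical_ring = ?I"
      then obtain q where "q \<in> carrier arithmetical_ring"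
        "\<one>\<^bsub>arithmetical_ring\<^esub> = q \<otimes>\<^bsub>arithmetical_ring\<^esub> f"
        using mem one_closed by blast
      then have "f \<in> Units arithmetical_ring"
        using f m_comm by (auto simp: Units_def)
      with that show False ..
    qed
  qed (rule dichotomy)
  then show ?thesis
    using ideal dichotomy by (auto simp: prime_ideal_or_whole_def)
qed

end
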